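(* Consider $N_{\mathcal B}$ bus objects and $W$ period buckets $\mathbf Q_1,\dots,\mathbf Q_W$ scheduled according to the static scheduling policy (rate-monotonic priorities on a preemptive single core, with a fixed internal order in every bucket). If $$\sum_{\beta=1}^{N_{\mathcal B}}\frac{\mathcal C^{\mathcal B}_\beta}{\mathcal P^{\mathcal B}_\beta}+\sum_{w=1}^{W}\frac{\mathcal C^{\mathbf Q}_w}{\mathcal T^{(w)}}\;\le\;(N_{\mathcal B}+W)\left(2^{1/(N_{\mathcal B}+W)}-1\right),$$ then the system is schedulable.
   Context: Platform: one processor core, fully preemptive fixed-priority scheduling starting at time $0$, scheduling tick $\delta>0$. Devices: there are $N\ge 1$ devices $d_1,\dots,d_N$. Device $d_n$ has a period $\mathcal T_n$, a positive integer multiple of $\delta$, and relative deadline $\mathcal D_n=\mathcal T_n$. It releases a task at every time $k\delta$ with $k\in\mathbb K_n=\{k\in\mathbb N: k\delta=\alpha\mathcal T_n\text{ for some }\alpha\in\mathbb N\}$ (so all devices release at time $0$). Each released task consists of two stages, the Update stage $\tau_n^+$ followed by the Handle stage $\tau_n^-$, whose total execution time is at most the worst-case execution time (WCET) $\mathcal C_n>0$. $F(\tau_n^{-},k)$ denotes the finish time of the Handle stage of the task released at $k\delta$. Initialization order and buckets: a fixed total order of the devices (the initialization order) is given. Let $\mathcal T^{(1)}<\dots<\mathcal T^{(W)}$ be the distinct device periods. The period bucket $\mathbf Q_w$ is the subsequence, in initialization order, of all devices with period $\mathcal T^{(w)}$. Its aggregate execution time is $\mathcal C^{\mathbf Q}_w=\sum_{d_n\in\mathbf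 Q_w}\mathcal C_n$. At each release of the bucket $\mathbf Q_w=(d_{n_1},\dots,d_{n_r})$ one job of the bucket is released, which executes the stages in the order $\tau_{n_1}^+,\tau_{n_2}^+,\dots,\tau_{n_r}^+,\tau_{n_r}^-,\dots,\tau_{n_2}^-,\tau_{n_1}^-$. Bus objects: bus $b_\beta$ ($\beta=1,\dots,N_{\mathcal B}$) generates responses whose release times are pairwise separated by at least $\mathcal T^{\mathcal B}_\beta=\ell_\beta/\mathscr R_\beta>0$ (minimum frame length divided by baud rate); each response needs at most $\mathcal C^{\mathcal B}_\beta>0$ units of execution. Put $\mathcal P^{\mathcal B}_\beta=\min\{\mathcal T^{\mathcal B}_\beta,\delta\}$. Static policy: priorities are rate-monotonic, using $\mathcal P^{\mathcal B}_\beta$ as the period of bus $b_\beta$ and $\mathcal T^{(w)}$ as the period of bucket $\mathbf Q_w$ (shorter period means higher priority); bus workloads have priority over all buckets. Higher-priority work preempts lower-priority work. Schedulable means that all deadlines are met: $F(\tau_n^-,k)\le k\delta+\mathcal D_n$ for all $n$ and all $k\in\mathbb K_n$, and every response of bus $b_\beta$ is completed within $\mathcal T^{\mathcal B}_\beta$ of its release. *)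

theory Defs
  imports "HOL-Analysis.Analysis"
begin

section \<open>Devices, period buckets and buses\<close>

text \<open>Devices are numbered 1..\<open>num_devices\<close> and buses 1..\<open>num_buses\<close>; \<open>init_order\<close> lists all
  devices in initialization order.\<close>

record sys =
  tick :: real
  num_devices :: nat
  period :: "nat \<Rightarrow> real"
  wcet :: "nat \<Rightarrow> real"
  init_order :: "nat list"
  num_buses :: nat
  frame_len :: "nat \<Rightarrow> real"
  baud_rate :: "nat \<Rightarrow> real"
  bus_wcet :: "nat \<Rightarrow> real"

definition deadline :: "sys \<Rightarrow> nat \<Rightarrow> real" where
  "deadline S n = period S n"

definition bus_sep :: "sys \<Rightarrow> nat \<Rightarrow> real" where
  "bus_sep S b = frame_len S b / baud_rate S b"

definition bus_period :: "sys \<Rightarrow> nat \<Rightarrow> real" where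
  "bus_period S b = min (bus_sep S b) (tick S)"

definition valid_sys :: "sys \<Rightarrow> bool" where
  "valid_sys S \<longleftrightarrow>
     tick S > 0 \<and> num_devices S \<ge> 1 \<and>
     (\<forall>n\<in>{1..num_devices S}.
        (\<exists>m::nat. m > 0 \<and> period S n = real m * tick S) \<and> wcet S n > 0) \<and>
     distinct (init_order S) \<and> set (init_order S) = {1..num_devices S} \<and>
     (\<forall>b\<in>{1..num_buses S}. bus_sep S b > 0 \<and> bus_wcet S b > 0)"

text \<open>The distinct device periods in increasing order; buckets are numbered 1..\<open>num_buckets\<close>.\<close>

definition distinct_periods :: "sys \<Rightarrow> real list" where
  "distinct_periods S = sorted_list_of_set (period S ` {1..num_devices S})"

definition num_buckets :: "sys \<Rightarrow> nat" where
  "num_buckets S = length (distinct_periods S)"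

definition bucket_period :: "sys \<Rightarrow> nat \<Rightarrow> real" where
  "bucket_period S w = distinct_periods S ! (w - 1)"

definition bucket :: "sys \<Rightarrow> nat \<Rightarrow> nat list" where
  "bucket S w = filter (\<lambda>n. period S n = bucket_period S w) (init_order S)"

definition bucket_of :: "sys \<Rightarrow> nat \<Rightarrow> nat" where
  "bucket_of S n = (THE w. w \<in> {1..num_buckets S} \<and> n \<in> set (bucket S w))"

definition bucket_wcet :: "sys \<Rightarrow> nat \<Rightarrow> real" where
  "bucket_wcet S w = (\<Sum>n\<in>set (bucket S w). wcet S n)"

definition release_ticks :: "sys \<Rightarrow> real \<Rightarrow> nat set" where
  "release_ticks S T = {k. \<exists>a::nat. real k * tick S = real a * T}"

lemma bucket_of_unique:
  assumes "valid_sys S" "n \<in> {1..num_devices S}"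
  shows "\<exists>!w. w \<in> {1..num_buckets S} \<and> n \<in> set (bucket S w)"
proof -
  let ?L = "distinct_periods S"
  have L: "set ?L = period S ` {1..num_devices S}" "distinct ?L"
    by (simp_all add: distinct_periods_def)
  have n: "n \<in> set (init_order S)"
    using assms by (simp add: valid_sys_def)
  have "period S n \<in> set ?L"
    using L assms by auto
  then obtain i where i: "i < length ?L" "?L ! i = period S n"
    by (auto simp: in_set_conv_nth)
  show ?thesis
  proof (rule ex1I[of _ "Suc i"])
    show "Suc i \<in> {1..num_buckets S} \<and> n \<in> set (bucket S (Suc i))"
      using i n by (auto simp: num_buckets_def bucket_def bucket_period_def)
  next
    fix w assume w: "w \<in> {1..num_buckets S} \<and> n \<in> set (bucket S w)"
    then have "w - 1 < length ?L" "?L ! (w - 1) = ?L ! i"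
      using i by (auto simp: num_buckets_def bucket_def bucket_period_def)
    then have "w - 1 = i"
      using i(1) L(2) by (metis nth_eq_iff_index_eq)
    then show "w = Suc i"
      using w by auto
  qed
qed


section \<open>Jobs\<close>

datatype workload = Bus nat | Bucket nat

datatype stage = Update nat | Handle nat

text \<open>\<open>Response b i\<close> is the \<open>i\<close>-th response of bus \<open>b\<close>; \<open>Bucket_job w k\<close> is the job of bucket \<open>w\<close>
  released at the \<open>k\<close>-th tick.\<close>

datatype job = Response nat nat | Bucket_job nat nat

primrec workload_of :: "job \<Rightarrow> workload" where
  "workload_of (Response b i) = Bus b"
| "workload_of (Bucket_job w k) = Bucket w"

text \<open>A scenario fixes what the system parameters leave open: which responses occur and when, and
  all actual execution times (at most the worst-case ones). \<open>stage_exec R s k\<close> is the execution time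
  of stage \<open>s\<close> of the task released at the \<open>k\<close>-th tick. The indices in \<open>responses R b\<close> are mere
  names: they may form any finite or infinite set and need not follow the order of release.\<close>

record scenario =
  responses :: "nat \<Rightarrow> nat set"
  arrival :: "nat \<Rightarrow> nat \<Rightarrow> real"
  response_exec :: "nat \<Rightarrow> nat \<Rightarrow> real"
  stage_exec :: "stage \<Rightarrow> nat \<Rightarrow> real"

definition valid_scenario :: "sys \<Rightarrow> scenario \<Rightarrow> bool" where
  "valid_scenario S R \<longleftrightarrow>
     (\<forall>b\<in>{1..num_buses S}.
        (\<forall>i\<in>responses R b. arrival R b i \<ge> 0 \<and>
            0 \<le> response_exec R b i \<and> response_exec R b i \<le> bus_wcet S b) \<and>
        (\<forall>i\<in>responses R b. \<forall>j\<in>responses R b.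
            i \<noteq> j \<longrightarrow> \<bar>arrival R b i - arrival R b j\<bar> \<ge> bus_sep S b)) \<and>
     (\<forall>n\<in>{1..num_devices S}. \<forall>k\<in>release_ticks S (period S n).
        0 \<le> stage_exec R (Update n) k \<and> 0 \<le> stage_exec R (Handle n) k \<and>
        stage_exec R (Update n) k + stage_exec R (Handle n) k \<le> wcet S n)"

definition jobs :: "sys \<Rightarrow> scenario \<Rightarrow> job set" where
  "jobs S R =
     {Response b i | b i. b \<in> {1..num_buses S} \<and> i \<in> responses R b} \<union>
     {Bucket_job w k | w k. w \<in> {1..num_buckets S} \<and> k \<in> release_ticks S (bucket_period S w)}"

primrec release :: "sys \<Rightarrow> scenario \<Rightarrow> job \<Rightarrow> real" where
  "release S R (Response b i) = arrival R b i"
| "release S R (Bucket_job w k) = real k * tick S"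

definition bucket_stages :: "sys \<Rightarrow> nat \<Rightarrow> stage list" where
  "bucket_stages S w = map Update (bucket S w) @ map Handle (rev (bucket S w))"

primrec demand :: "sys \<Rightarrow> scenario \<Rightarrow> job \<Rightarrow> real" where
  "demand S R (Response b i) = response_exec R b i"
| "demand S R (Bucket_job w k) = (\<Sum>s\<leftarrow>bucket_stages S w. stage_exec R s k)"

text \<open>A bucket job spends its processor time on its stages one after the other, so it completes
  stage \<open>s\<close> once it has received enough time for \<open>s\<close> and all stages before \<open>s\<close>.\<close>

definition demand_through :: "sys \<Rightarrow> scenario \<Rightarrow> nat \<Rightarrow> nat \<Rightarrow> stage \<Rightarrow> real" where
  "demand_through S R w k s =
     (\<Sum>s'\<leftarrow>takeWhile (\<lambda>s'. s' \<noteq> s) (bucket_stages S w). stage_exec R s' k) + stage_exec R s k"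


section \<open>Schedules produced by the static policy\<close>

fun higher_priority :: "sys \<Rightarrow> workload \<Rightarrow> workload \<Rightarrow> bool" where
  "higher_priority S (Bus b) (Bus b') \<longleftrightarrow> bus_period S b < bus_period S b'"
| "higher_priority S (Bus b) (Bucket w) \<longleftrightarrow> True"
| "higher_priority S (Bucket w) (Bus b) \<longleftrightarrow> False"
| "higher_priority S (Bucket w) (Bucket w') \<longleftrightarrow> bucket_period S w < bucket_period S w'"

text \<open>A schedule tells which job, if any, occupies the processor at each time \<open>t \<ge> 0\<close>.\<close>

type_synonym schedule = "real \<Rightarrow> job option"

definition service :: "schedule \<Rightarrow> job \<Rightarrow> real \<Rightarrow> real" where
  "service \<sigma> j t = measure lborel {u\<in>{0..<t}. \<sigma> u = Some j}"

definition pending :: "sys \<Rightarrow> scenario \<Rightarrow> schedule \<Rightarrow> real \<Rightarrow> job set" where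
  "pending S R \<sigma> t =
     {j \<in> jobs S R. release S R j \<le> t \<and> service \<sigma> j t < demand S R j}"

text \<open>The processor never idles while a job is pending, and always runs a pending job of highest
  priority. Ties (buses of equal period, or jobs of the same workload) may be broken in any way;
  every fixed tie-breaking rule is covered.\<close>

definition static_schedule :: "sys \<Rightarrow> scenario \<Rightarrow> schedule \<Rightarrow> bool" where
  "static_schedule S R \<sigma> \<longleftrightarrow>
     (\<forall>j. {t. 0 \<le> t \<and> \<sigma> t = Some j} \<in> sets lborel) \<and>
     (\<forall>t\<ge>0. case \<sigma> t of
        None \<Rightarrow> pending S R \<sigma> t = {}
      | Some j \<Rightarrow> j \<in> pending S R \<sigma> t \<and>
          (\<forall>i\<in>pending S R \<sigma> t. \<not> higher_priority S (workload_of i) (workload_of j)))"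


section \<open>Finish times and schedulability\<close>

text \<open>Finish times are extended reals: the finish time of work that never completes is
  \<open>Inf {} = \<infinity>\<close>.\<close>

definition handle_finish :: "sys \<Rightarrow> scenario \<Rightarrow> schedule \<Rightarrow> nat \<Rightarrow> nat \<Rightarrow> ereal" where
  "handle_finish S R \<sigma> n k =
     (let w = bucket_of S n in
      Inf (ereal ` {t. release S R (Bucket_job w k) \<le> t \<and>
                       demand_through S R w k (Handle n) \<le> service \<sigma> (Bucket_job w k) t}))"

definition response_finish :: "sys \<Rightarrow> scenario \<Rightarrow> schedule \<Rightarrow> nat \<Rightarrow> nat \<Rightarrow> ereal" where
  "response_finish S R \<sigma> b i =
     Inf (ereal ` {t. release S R (Response b i) \<le> t \<and>
                      demand S R (Response b i) \<le> service \<sigma> (Response b i) t})"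

definition meets_deadlines :: "sys \<Rightarrow> scenario \<Rightarrow> schedule \<Rightarrow> bool" where
  "meets_deadlines S R \<sigma> \<longleftrightarrow>
     (\<forall>n\<in>{1..num_devices S}. \<forall>k\<in>release_ticks S (period S n).
        handle_finish S R \<sigma> n k \<le> ereal (real k * tick S + deadline S n)) \<and>
     (\<forall>b\<in>{1..num_buses S}. \<forall>i\<in>responses R b.
        response_finish S R \<sigma> b i \<le> ereal (arrival R b i + bus_sep S b))"

definition schedulable :: "sys \<Rightarrow> bool" where
  "schedulable S \<longleftrightarrow>
     (\<forall>R \<sigma>. valid_scenario S R \<longrightarrow> static_schedule S R \<sigma> \<longrightarrow> meets_deadlines S R \<sigma>)"

end

theory Submission
  imports Defs
begin

text \<open>If a job of workload \<open>v\<close> is late, go back to the last instant \<open>s\<close> before its release at which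
  nothing of priority not lower than \<open>v\<close> (ties included) was left over. From \<open>s\<close> on the processor
  executes only such work released since \<open>s\<close>, so \<open>t < (\<Sum>i. C i * \<lceil>t / T i\<rceil>)\<close> for every \<open>t\<close> in
  \<open>(0, T v]\<close>, the sum ranging over the workloads \<open>i\<close> of priority not lower than \<open>v\<close>. Taking for \<open>t\<close>
  the last multiple of each period up to \<open>T v\<close> and combining these inequalities in increasing order
  of \<open>t\<close> yields \<open>(\<Prod>i. 1 + C i / T i) > 2\<close> (the hyperbolic bound of Bini and Buttazzo), whereas the
  utilization hypothesis and the inequality of arithmetic and geometric means give \<open>\<le> 2\<close>.\<close>

section \<open>The utilization bound\<close>

text \<open>Indices are added in increasing order of \<open>x\<close>. Each new \<open>x k\<close>
  is below the partial sum reached so far, so adding \<open>u k * x k\<close> multiplies that sum by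
  less than \<open>1 + u k\<close>.\<close>

lemma staircase_sum_less_prod:
  fixes x u :: "'a \<Rightarrow> real"
  assumes "finite I" "I \<noteq> {}"
    and "\<And>i. i \<in> I \<Longrightarrow> 0 < u i"
    and "\<And>j. j \<in> I \<Longrightarrow> x j < a + (\<Sum>i | i \<in> I \<and> x i < x j. u i * x i)"
    and "\<And>i. i \<in> I \<Longrightarrow> 0 < x i"
  shows "a + (\<Sum>i\<in>I. u i * x i) < a * (\<Prod>i\<in>I. 1 + u i)"
  using assms
proof (induction I rule: finite_ranking_induct[where f = x])
  case empty
  then show ?case by simp
next
  case (insert k I)
  show ?case
  proof (cases "k \<in> I")
    case True
    then show ?thesis
      using insert by (simp add: insert_absorb)
  next
    case False
    \<comment> \<open>The new index \<open>k\<close> has the largest \<open>x\<close>, so it lies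
      strictly below no index and the hypothesis for \<open>insert k I\<close> restricts to
      \<open>I\<close>.\<close>
    have below: "{i \<in> insert k I. x i < x j} = {i \<in> I. x i < x j}" if "j \<in> insert k I" for j
      using that insert(2) by fastforce
    have xk: "x k < a + (\<Sum>i\<in>I. u i * x i)"
    proof -
      have "x k < a + (\<Sum>i | i \<in> I \<and> x i < x k. u i * x i)"
        using insert.prems(3)[of k] below[of k] by simp
      also have "\<dots> \<le> a + (\<Sum>i\<in>I. u i * x i)"
        using insert.hyps(1) insert.prems(2,4)
        by (intro add_left_mono sum_mono2) (auto intro!: mult_nonneg_nonneg simp: less_imp_le)
      finally show ?thesis .
    qed
    \<comment> \<open>Weakened to \<open>\<le>\<close> so that it also covers empty
      \<open>I\<close>, where equality holds; strictness is regained below from \<open>xk\<close>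
      and \<open>0 < u k\<close>.\<close>
    have IH: "a + (\<Sum>i\<in>I. u i * x i) \<le> a * (\<Prod>i\<in>I. 1 + u i)"
    proof (cases "I = {}")
      case True
      then show ?thesis by simp
    next
      case nonempty: False
      have "a + (\<Sum>i\<in>I. u i * x i) < a * (\<Prod>i\<in>I. 1 + u i)"
      proof (rule insert.IH[OF nonempty])
        fix j assume "j \<in> I"
        then show "x j < a + (\<Sum>i | i \<in> I \<and> x i < x j. u i * x i)"
          using insert.prems(3)[of j] below[of j] by simp
      qed (use insert.prems in auto)
      then show ?thesis by simp
    qed
    have uk: "0 < u k"
      using insert.prems(2) by simp
    have "a + (\<Sum>i\<in>insert k I. u i * x i) = (a + (\<Sum>i\<in>I. u i * x i)) + u k * x k"
      using False insert.hyps(1) by simp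
    also have "\<dots> < (a + (\<Sum>i\<in>I. u i * x i)) + u k * (a + (\<Sum>i\<in>I. u i * x i))"
      using xk uk by simp
    also have "\<dots> = (1 + u k) * (a + (\<Sum>i\<in>I. u i * x i))"
      by (simp add: algebra_simps)
    also have "\<dots> \<le> (1 + u k) * (a * (\<Prod>i\<in>I. 1 + u i))"
      using IH uk by (intro mult_left_mono) auto
    also have "\<dots> = a * (\<Prod>i\<in>insert k I. 1 + u i)"
      using False insert.hyps(1) by (simp add: mult_ac)
    finally show ?thesis .
  qed
qed

lemma hyperbolic_bound:
  fixes p c :: "'a \<Rightarrow> real"
  assumes fin: "finite I" and k: "k \<in> I"
    and p: "\<And>i. i \<in> I \<Longrightarrow> 0 < p i" "\<And>i. i \<in> I \<Longrightarrow> p i \<le> p k"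
    and c: "\<And>i. i \<in> I \<Longrightarrow> 0 < c i"
    and prod: "(\<Prod>i\<in>I. 1 + c i / p i) \<le> 2"
  shows "\<exists>t. 0 < t \<and> t \<le> p k \<and> (\<Sum>i\<in>I. c i * \<lceil>t / p i\<rceil>) \<le> t"
proof (rule ccontr)
  assume "\<not> ?thesis"
  then have overload: "t < (\<Sum>i\<in>I. c i * \<lceil>t / p i\<rceil>)" if "0 < t" "t \<le> p k" for t
    using that by (meson not_le)
  \<comment> \<open>\<open>x i\<close> is the last multiple of \<open>p i\<close> not exceeding
    \<open>p k\<close>, and \<open>a\<close> is the demand of the \<open>f i\<close> full periods
    before it, summed over all \<open>i\<close>.\<close>
  define f where "f i = real_of_int \<lfloor>p k / p i\<rfloor>" for i
  define x where "x i = f i * p i" for i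
  define u where "u i = c i / p i" for i
  define a where "a = (\<Sum>i\<in>I. u i * x i)"
  have f: "1 \<le> f i" "f i \<le> p k / p i" "p k / p i < f i + 1" if "i \<in> I" for i
  proof -
    have "1 \<le> p k / p i"
      using p that by simp
    then show "1 \<le> f i"
      by (simp add: f_def le_floor_iff)
  qed (auto simp: f_def)
  have x: "0 < x i" "x i \<le> p k" if "i \<in> I" for i
    using f[OF that] p(1)[OF that] by (auto simp: x_def field_simps intro!: mult_pos_pos)
  have ux: "u i * x i = c i * f i" if "i \<in> I" for i
    using p(1)[OF that] by (simp add: u_def x_def)
  have "a + (\<Sum>i\<in>I. u i * x i) < a * (\<Prod>i\<in>I. 1 + u i)"
  proof (rule staircase_sum_less_prod)
    fix j assume j: "j \<in> I"
    have "x j < (\<Sum>i\<in>I. c i * \<lceil>x j / p i\<rceil>)"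
      using overload x j by simp
    \<comment> \<open>Index \<open>i\<close> has released at most \<open>f i\<close> jobs before
      \<open>x j\<close>, plus one more if \<open>x i < x j\<close>. Since
      \<open>1 \<le> f i\<close>, that extra job costs at most \<open>c i * f i = u i * x i\<close>,
      which gives the shape required by the staircase lemma.\<close>
    also have "\<dots> \<le> (\<Sum>i\<in>I. u i * x i + (if x i < x j then u i * x i else 0))"
    proof (rule sum_mono)
      fix i assume i: "i \<in> I"
      show "c i * \<lceil>x j / p i\<rceil> \<le> u i * x i + (if x i < x j then u i * x i else 0)"
      proof (cases "x i < x j")
        case True
        have "x j / p i \<le> p k / p i"
          using x(2)[OF j] p(1)[OF i] by (simp add: divide_right_mono)
        then have "\<lceil>x j / p i\<rceil> \<le> \<lfloor>p k / p i\<rfloor> + 1"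
          by linarith
        then have "real_of_int \<lceil>x j / p i\<rceil> \<le> f i + f i"
          using f(1)[OF i] unfolding f_def by linarith
        then have "c i * \<lceil>x j / p i\<rceil> \<le> c i * (f i + f i)"
          using c[OF i] by (intro mult_left_mono) auto
        then show ?thesis
          using True ux[OF i] by (simp add: algebra_simps)
      next
        case False
        then have "x j / p i \<le> f i"
          using p(1)[OF i] by (simp add: x_def field_simps)
        then have "real_of_int \<lceil>x j / p i\<rceil> \<le> f i"
          unfolding f_def by (simp add: ceiling_le_iff)
        then show ?thesis
          using False c[OF i] ux[OF i] by simp
      qed
    qed
    also have "\<dots> = a + (\<Sum>i | i \<in> I \<and> x i < x j. u i * x i)"
      using fin by (simp add: sum.distrib a_def sum.inter_filter)
    finally show "x j < a + (\<Sum>i | i \<in> I \<and> x i < x j. u i * x i)" .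
  qed (use fin k x c p in \<open>auto simp: u_def\<close>)
  moreover have "0 < a"
    unfolding a_def using fin k x c p by (intro sum_pos) (auto simp: u_def)
  \<comment> \<open>The left side of the strict inequality is \<open>a + a\<close>, so
    \<open>a\<close> cancels.\<close>
  ultimately have "2 < (\<Prod>i\<in>I. 1 + u i)"
    by (simp add: a_def flip: mult_2)
  then show False
    using prod by (simp add: u_def)
qed

lemma prod_le_2_if_utilization_le:
  fixes u :: "'a \<Rightarrow> real"
  assumes "finite I" "I \<noteq> {}" and u: "\<And>i. i \<in> I \<Longrightarrow> 0 \<le> u i"
    and "(\<Sum>i\<in>I. u i) \<le> card I * (2 powr (1 / card I) - 1)"
  shows "(\<Prod>i\<in>I. 1 + u i) \<le> 2"
proof -
  have m: "0 < card I"
    using assms by (simp add: card_gt_0_iff)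
  have "(\<Prod>i\<in>I. 1 + u i) powr (1 / card I) \<le> (\<Sum>i\<in>I. (1 + u i) / card I)"
    using assms by (intro arith_geom_mean) auto
  also have "\<dots> = 1 + (\<Sum>i\<in>I. u i) / card I"
    using m by (simp add: sum.distrib add_divide_distrib flip: sum_divide_distrib)
  also have "\<dots> \<le> 2 powr (1 / card I)"
    using assms(4) m by (simp add: field_simps)
  finally show ?thesis
    using m powr_less_mono2[of "1 / card I" 2 "\<Prod>i\<in>I. 1 + u i"] by (force simp: not_le)
qed

section \<open>Counting releases\<close>

text \<open>Cut the interval into cells of length \<open>p\<close>, counted from \<open>s\<close>.
  Separation puts at most one point into each cell, and as the interval is half-open, only the first
  \<open>\<lceil>t / p\<rceil>\<close> cells can be hit.\<close>

lemma separated_in_interval: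
  fixes f :: "'a \<Rightarrow> real"
  assumes p: "0 < p" and t: "0 \<le> t" and A: "f ` A \<subseteq> {s..<s + t}"
    and sep: "\<And>i j. i \<in> A \<Longrightarrow> j \<in> A \<Longrightarrow> i \<noteq> j \<Longrightarrow> p \<le> \<bar>f i - f j\<bar>"
  shows "finite A" "real (card A) \<le> \<lceil>t / p\<rceil>"
proof -
  define g where "g i = \<lfloor>(f i - s) / p\<rfloor>" for i
  have inj: "inj_on g A"
  proof (rule inj_onI, rule ccontr)
    fix i j assume ij: "i \<in> A" "j \<in> A" "g i = g j" "i \<noteq> j"
    have "\<bar>(f i - s) / p - (f j - s) / p\<bar> = \<bar>f i - f j\<bar> / p"
      using p by (simp flip: diff_divide_distrib)
    moreover have "1 \<le> \<bar>f i - f j\<bar> / p"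
      using sep[of i j] ij p by simp
    ultimately show False
      using ij(3) unfolding g_def by linarith
  qed
  have sub: "g ` A \<subseteq> {0..<\<lceil>t / p\<rceil>}"
  proof
    fix z assume "z \<in> g ` A"
    then obtain i where i: "i \<in> A" "z = g i" by auto
    have "0 \<le> (f i - s) / p" "(f i - s) / p < t / p"
      using A i p by (force simp: divide_strict_right_mono)+
    then show "z \<in> {0..<\<lceil>t / p\<rceil>}"
      using i unfolding g_def by (auto simp: floor_less_iff) linarith
  qed
  show "finite A"
    using inj sub finite_subset finite_imageD by blast
  have "card A \<le> nat \<lceil>t / p\<rceil>"
    using card_mono[OF _ sub] card_image[OF inj] by simp
  moreover have "0 \<le> \<lceil>t / p\<rceil>"
    using p t ceiling_mono[of 0 "t / p"] by simp
  ultimately show "real (card A) \<le> \<lceil>t / p\<rceil>"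
    by linarith
qed

section \<open>Workloads as sporadic tasks\<close>

fun workload_period :: "sys \<Rightarrow> workload \<Rightarrow> real" where
  "workload_period S (Bus b) = bus_period S b"
| "workload_period S (Bucket w) = bucket_period S w"

fun workload_wcet :: "sys \<Rightarrow> workload \<Rightarrow> real" where
  "workload_wcet S (Bus b) = bus_wcet S b"
| "workload_wcet S (Bucket w) = bucket_wcet S w"

definition workloads :: "sys \<Rightarrow> workload set" where
  "workloads S = Bus ` {1..num_buses S} \<union> Bucket ` {1..num_buckets S}"

lemma finite_workloads [simp]: "finite (workloads S)"
  by (simp add: workloads_def)

lemma card_workloads: "card (workloads S) = num_buses S + num_buckets S"
  unfolding workloads_def by (subst card_Un_disjoint) (auto simp: card_image inj_on_def)

lemma sum_workloads:
  "(\<Sum>v\<in>workloads S. g v)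
     = (\<Sum>b\<in>{1..num_buses S}. g (Bus b)) + (\<Sum>w\<in>{1..num_buckets S}. g (Bucket w))"
  unfolding workloads_def by (subst sum.union_disjoint) (auto simp: sum.reindex inj_on_def)

section \<open>Elementary facts on buckets, periods and priorities\<close>

lemma bucket_period_in_periods:
  assumes "w \<in> {1..num_buckets S}"
  shows "bucket_period S w \<in> period S ` {1..num_devices S}"
proof -
  have "bucket_period S w \<in> set (distinct_periods S)"
    using assms unfolding bucket_period_def num_buckets_def by (intro nth_mem) auto
  then show ?thesis
    by (simp add: distinct_periods_def)
qed

lemma tick_le_bucket_period:
  assumes "valid_sys S" "w \<in> {1..num_buckets S}"
  shows "tick S \<le> bucket_period S w"
proof -
  obtain n where "n \<in> {1..num_devices S}" "bucket_period S w = period S n"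
    using bucket_period_in_periods[OF assms(2)] by auto
  then obtain m :: nat where "0 < m" "bucket_period S w = m * tick S"
    using assms(1) unfolding valid_sys_def by metis
  then show ?thesis
    using assms(1) by (simp add: valid_sys_def)
qed

lemma distinct_bucket: "valid_sys S \<Longrightarrow> distinct (bucket S w)"
  by (simp add: bucket_def valid_sys_def)

lemma in_bucketD:
  assumes "valid_sys S" "n \<in> set (bucket S w)"
  shows "n \<in> {1..num_devices S}" "period S n = bucket_period S w"
  using assms by (auto simp: bucket_def valid_sys_def)

lemma bucket_nonempty:
  assumes "valid_sys S" "w \<in> {1..num_buckets S}"
  shows "set (bucket S w) \<noteq> {}"
  using bucket_period_in_periods[OF assms(2)] assms(1)
  by (auto simp: bucket_def valid_sys_def filter_empty_conv)

lemma bucket_of: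
  assumes "valid_sys S" "n \<in> {1..num_devices S}"
  shows "bucket_of S n \<in> {1..num_buckets S}" "n \<in> set (bucket S (bucket_of S n))"
  using theI'[OF bucket_of_unique[OF assms]] by (auto simp: bucket_of_def)

lemma num_buckets_pos:
  assumes "valid_sys S"
  shows "0 < num_buckets S"
  using bucket_of(1)[OF assms, of 1] assms by (simp add: valid_sys_def)

lemma workload_period_pos:
  assumes "valid_sys S" "v \<in> workloads S"
  shows "0 < workload_period S v"
  using assms tick_le_bucket_period[OF assms(1)]
  by (fastforce simp: workloads_def valid_sys_def bus_period_def)

lemma workload_wcet_pos:
  assumes "valid_sys S" "v \<in> workloads S"
  shows "0 < workload_wcet S v"
proof (cases v)
  case (Bus b)
  then show ?thesis
    using assms by (auto simp: workloads_def valid_sys_def)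
next
  case (Bucket w)
  then have "w \<in> {1..num_buckets S}"
    using assms by (auto simp: workloads_def)
  then have "0 < bucket_wcet S w"
    unfolding bucket_wcet_def using bucket_nonempty[OF assms(1)] in_bucketD(1)[OF assms(1)] assms(1)
    by (intro sum_pos) (auto simp: valid_sys_def)
  then show ?thesis
    using Bucket by simp
qed

text \<open>Buses precede buckets by decree, yet the policy remains rate-monotonic: the minimum with
  the tick keeps every bus period at or below the tick, and bucket periods are positive multiples of
  the tick.\<close>

lemma workload_period_le:
  assumes "valid_sys S" "v \<in> workloads S" "v' \<in> workloads S" "\<not> higher_priority S v v'"
  shows "workload_period S v' \<le> workload_period S v"
proof (cases v; cases v')
  fix w b assume "v = Bucket w" "v' = Bus b"
  then show ?thesis
    using assms tick_le_bucket_period[OF assms(1), of w]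
    by (auto simp: workloads_def bus_period_def)
qed (use assms in auto)

lemma higher_priority_irrefl: "\<not> higher_priority S v v"
  by (cases v) auto

text \<open>Contraposed, "not of higher priority than" is transitive. This is what allows ties to be
  broken arbitrarily.\<close>

lemma higher_priority_cotrans:
  "higher_priority S v v' \<Longrightarrow> higher_priority S v v'' \<or> higher_priority S v'' v'"
  by (cases v; cases v'; cases v'') auto

section \<open>Demand of the jobs in a fixed run\<close>

locale static_run =
  fixes S :: sys and R :: scenario and \<sigma> :: schedule
  assumes valid_sys: "valid_sys S"
    and valid_scenario: "valid_scenario S R"
    and static_schedule: "static_schedule S R \<sigma>"
begin

lemma workload_of_job: "j \<in> jobs S R \<Longrightarrow> workload_of j \<in> workloads S"
  by (auto simp: jobs_def workloads_def)

lemma release_nonneg: "j \<in> jobs S R \<Longrightarrow> 0 \<le> release S R j"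
  using valid_scenario valid_sys by (auto simp: jobs_def valid_scenario_def valid_sys_def)

lemma stage_exec_nonneg:
  assumes "k \<in> release_ticks S (bucket_period S w)" "s \<in> set (bucket_stages S w)"
  shows "0 \<le> stage_exec R s k"
  using assms valid_scenario in_bucketD[OF valid_sys, of _ w]
  by (fastforce simp: bucket_stages_def valid_scenario_def)

lemma demand_bounds:
  assumes "j \<in> jobs S R"
  shows "0 \<le> demand S R j" "demand S R j \<le> workload_wcet S (workload_of j)"
proof -
  have "0 \<le> demand S R j \<and> demand S R j \<le> workload_wcet S (workload_of j)"
  proof (cases j)
    case (Response b i)
    then show ?thesis
      using assms valid_scenario by (auto simp: jobs_def valid_scenario_def)
  next
    case (Bucket_job w k)
    have k: "k \<in> release_ticks S (bucket_period S w)"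
      using assms Bucket_job by (auto simp: jobs_def)
    \<comment> \<open>The stage list is regrouped by device, because the execution time bound is on
      the sum of the two stages of a device.\<close>
    have "demand S R j
        = (\<Sum>n\<in>set (bucket S w). stage_exec R (Update n) k + stage_exec R (Handle n) k)"
      using distinct_bucket[OF valid_sys, of w] Bucket_job
      by (simp add: bucket_stages_def comp_def sum_list_distinct_conv_sum_set sum.distrib)
    also have "\<dots> \<le> bucket_wcet S w"
      unfolding bucket_wcet_def
      using in_bucketD[OF valid_sys, of _ w] valid_scenario k
      by (intro sum_mono) (auto simp: valid_scenario_def)
    finally show ?thesis
      using stage_exec_nonneg[OF k] Bucket_job by (auto intro!: sum_list_nonneg)
  qed
  then show "0 \<le> demand S R j" "demand S R j \<le> workload_wcet S (workload_of j)"
    by simp_all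
qed

text \<open>Reduces the finish of a single stage to the completion of the whole bucket job, whatever
  the internal order of the bucket.\<close>

lemma demand_through_le_demand:
  assumes k: "k \<in> release_ticks S (bucket_period S w)" and s: "s \<in> set (bucket_stages S w)"
  shows "demand_through S R w k s \<le> demand S R (Bucket_job w k)"
proof -
  obtain pre rest where stages: "bucket_stages S w = pre @ s # rest" and "s \<notin> set pre"
    using split_list_first[OF s] by blast
  then have "takeWhile (\<lambda>s'. s' \<noteq> s) (bucket_stages S w) = pre"
    by (subst stages, subst takeWhile_append2) auto
  moreover have "0 \<le> (\<Sum>s\<leftarrow>rest. stage_exec R s k)"
    using stage_exec_nonneg[OF k] by (intro sum_list_nonneg) (auto simp: stages)
  ultimately show ?thesis
    by (simp add: demand_through_def stages)
qed

text \<open>Distinct multiples of a bucket period differ by at least that period; for a bus, the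
  workload period is at most the guaranteed separation.\<close>

lemma release_separation:
  assumes "i \<in> jobs S R" "j \<in> jobs S R" "workload_of i = workload_of j" "i \<noteq> j"
  shows "workload_period S (workload_of j) \<le> \<bar>release S R i - release S R j\<bar>"
proof (cases j)
  case (Response b m)
  then obtain l where i: "i = Response b l"
    using assms(3) by (cases i) auto
  then have "bus_sep S b \<le> \<bar>arrival R b l - arrival R b m\<bar>"
    using assms Response valid_scenario by (auto simp: jobs_def valid_scenario_def)
  then show ?thesis
    using Response i by (simp add: bus_period_def)
next
  case (Bucket_job w m)
  then obtain l where i: "i = Bucket_job w l"
    using assms(3) by (cases i) auto
  let ?T = "bucket_period S w"
  have w: "w \<in> {1..num_buckets S}"
    using assms Bucket_job by (auto simp: jobs_def)
  have pos: "0 < tick S" "0 < ?T"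
    using valid_sys tick_le_bucket_period[OF valid_sys w] by (auto simp: valid_sys_def)
  obtain a b :: nat where ab: "real l * tick S = a * ?T" "real m * tick S = b * ?T"
    using assms i Bucket_job by (auto simp: jobs_def release_ticks_def)
  moreover have "real l * tick S \<noteq> real m * tick S"
    using assms(4) i Bucket_job pos by simp
  ultimately have "a \<noteq> b"
    by auto
  then have "1 \<le> \<bar>real a - real b\<bar>"
    by linarith
  then have "?T \<le> \<bar>real a - real b\<bar> * ?T"
    using pos by simp
  also have "\<dots> = \<bar>real l * tick S - real m * tick S\<bar>"
    using pos unfolding ab by (simp add: abs_mult flip: left_diff_distrib)
  finally show ?thesis
    using Bucket_job i by simp
qed

text \<open>The request bound function: jobs are grouped by workload, each group is counted by the
  separation of its releases, and every job is charged its worst case.\<close>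

lemma demand_of_interval:
  fixes s t :: real
  assumes t: "0 \<le> t" and V: "V \<subseteq> workloads S"
  defines "F \<equiv> {j \<in> jobs S R. workload_of j \<in> V \<and> s \<le> release S R j \<and> release S R j < s + t}"
  shows "finite F"
    and "(\<Sum>j\<in>F. demand S R j) \<le> (\<Sum>v\<in>V. workload_wcet S v * \<lceil>t / workload_period S v\<rceil>)"
proof -
  define G where "G v = {j \<in> F. workload_of j = v}" for v
  have G: "finite (G v)" "real (card (G v)) \<le> \<lceil>t / workload_period S v\<rceil>" if "v \<in> V" for v
  proof -
    have pos: "0 < workload_period S v"
      using that V workload_period_pos[OF valid_sys] by auto
    have sub: "release S R ` G v \<subseteq> {s..<s + t}"
      by (auto simp: G_def F_def)
    have sep: "workload_period S v \<le> \<bar>release S R i - release S R j\<bar>"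
      if "i \<in> G v" "j \<in> G v" "i \<noteq> j" for i j
      using release_separation[of i j] that by (auto simp: G_def F_def)
    show "finite (G v)" "real (card (G v)) \<le> \<lceil>t / workload_period S v\<rceil>"
      using separated_in_interval[OF pos t sub sep] by simp_all
  qed
  have finV: "finite V"
    using V by (rule finite_subset) simp
  have F: "F = (\<Union>v\<in>V. G v)"
    by (auto simp: G_def F_def)
  show "finite F"
    unfolding F using finV G(1) by blast
  have "(\<Sum>j\<in>F. demand S R j) = (\<Sum>v\<in>V. \<Sum>j\<in>G v. demand S R j)"
    unfolding F using finV G(1) by (intro sum.UNION_disjoint) (auto simp: G_def)
  also have "\<dots> \<le> (\<Sum>v\<in>V. workload_wcet S v * \<lceil>t / workload_period S v\<rceil>)"
  proof (rule sum_mono)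
    fix v assume v: "v \<in> V"
    have "(\<Sum>j\<in>G v. demand S R j) \<le> card (G v) * workload_wcet S v"
      using demand_bounds(2) by (intro sum_bounded_above) (auto simp: G_def F_def)
    also have "\<dots> \<le> workload_wcet S v * \<lceil>t / workload_period S v\<rceil>"
      using G(2)[OF v] workload_wcet_pos[OF valid_sys, of v] v V
      by (subst mult.commute) (auto intro!: mult_left_mono)
    finally show "(\<Sum>j\<in>G v. demand S R j) \<le> workload_wcet S v * \<lceil>t / workload_period S v\<rceil>" .
  qed
  finally show "(\<Sum>j\<in>F. demand S R j) \<le> \<dots>" .
qed

section \<open>Service and busy intervals\<close>

lemma running_sets: "{u \<in> {0..<t}. \<sigma> u = Some j} \<in> sets lborel"
proof -
  have "{t. 0 \<le> t \<and> \<sigma> t = Some j} \<inter> {0..<t} \<in> sets lborel"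
    using static_schedule by (intro sets.Int) (auto simp: static_schedule_def)
  also have "{t. 0 \<le> t \<and> \<sigma> t = Some j} \<inter> {0..<t} = {u \<in> {0..<t}. \<sigma> u = Some j}"
    by auto
  finally show ?thesis .
qed

lemma running_fmeasurable: "{u \<in> {0..<t}. \<sigma> u = Some j} \<in> fmeasurable lborel"
proof (rule fmeasurableI2)
  show "{0..<t} \<in> fmeasurable lborel"
    by (cases "0 \<le> t") (auto intro!: fmeasurableI)
qed (use running_sets in auto)

lemma service_mono: "t \<le> t' \<Longrightarrow> service \<sigma> j t \<le> service \<sigma> j t'"
  unfolding service_def
  by (intro measure_mono_fmeasurable running_sets running_fmeasurable) auto

lemma running_pending:
  assumes "0 \<le> t" "\<sigma> t = Some j"
  shows "j \<in> pending S R \<sigma> t"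
  using static_schedule assms by (force simp: static_schedule_def split: option.splits)

text \<open>A job runs only while its service is below its demand. Take a running instant
  \<open>v\<close> within \<open>e\<close> of the supremum of all running instants before
  \<open>t\<close>: service up to \<open>v\<close> is below the demand, and at most \<open>e\<close>
  is added afterwards.\<close>

lemma service_le_demand:
  assumes j: "j \<in> jobs S R"
  shows "service \<sigma> j t \<le> demand S R j"
proof (rule field_le_epsilon)
  fix e :: real assume e: "0 < e"
  define E where "E = {u \<in> {0..<t}. \<sigma> u = Some j}"
  show "service \<sigma> j t \<le> demand S R j + e"
  proof (cases "E = {}")
    case True
    then have "service \<sigma> j t = 0"
      unfolding service_def E_def by (simp only: measure_empty)
    then show ?thesis
      using demand_bounds(1)[OF j] e by simp
  next
    case False
    have bdd: "bdd_above E"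
      by (rule bdd_aboveI[of _ t]) (auto simp: E_def)
    obtain v where v: "v \<in> E" "Sup E - e < v"
      using less_cSupD[OF False, of "Sup E - e"] e by auto
    have v': "0 \<le> v" "\<sigma> v = Some j"
      using v by (auto simp: E_def)
    have le: "E \<subseteq> {u \<in> {0..<v}. \<sigma> u = Some j} \<union> {v..v + e}"
    proof
      fix u assume "u \<in> E"
      then show "u \<in> {u \<in> {0..<v}. \<sigma> u = Some j} \<union> {v..v + e}"
        using cSup_upper[OF _ bdd, of u] v by (auto simp: E_def)
    qed
    have "service \<sigma> j t \<le> measure lborel ({u \<in> {0..<v}. \<sigma> u = Some j} \<union> {v..v + e})"
      unfolding service_def using e
      by (intro measure_mono_fmeasurable fmeasurable.Un running_sets running_fmeasurable
          le[unfolded E_def]) (auto intro!: fmeasurableI)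
    also have "\<dots> \<le> service \<sigma> j v + measure lborel {v..v + e}"
      unfolding service_def by (intro measure_Un_le running_sets) simp
    also have "\<dots> \<le> demand S R j + e"
      using running_pending[OF v'] e by (simp add: pending_def)
    finally show ?thesis .
  qed
qed

text \<open>Pending work forbids idling, and the running job is not outranked by the pending
  \<open>i\<close>, so it belongs to the same level by cotransitivity.\<close>

lemma running_at_level:
  assumes t: "0 \<le> t" and i: "i \<in> pending S R \<sigma> t" "\<not> higher_priority S v (workload_of i)"
  obtains j where "\<sigma> t = Some j" "j \<in> pending S R \<sigma> t" "\<not> higher_priority S v (workload_of j)"
proof -
  obtain j where j: "\<sigma> t = Some j"
    using static_schedule t i by (fastforce simp: static_schedule_def split: option.splits)
  then have "\<not> higher_priority S (workload_of i) (workload_of j)"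
    using static_schedule t i by (force simp: static_schedule_def split: option.splits)
  then show ?thesis
    using that[OF j running_pending[OF t j]] i(2) higher_priority_cotrans by blast
qed

text \<open>No induction over the jobs is needed: the level includes the workload of \<open>j\<close> itself (and
  all tied workloads), so a late predecessor of \<open>j\<close> merely moves the start \<open>s\<close> of the busy interval
  to the left.\<close>

lemma busy_interval:
  assumes j: "j \<in> jobs S R" and d: "release S R j < d"
    and late: "service \<sigma> j d < demand S R j"
  defines "L \<equiv> {i \<in> jobs S R. \<not> higher_priority S (workload_of j) (workload_of i)}"
  obtains s where "0 \<le> s" "s \<le> release S R j"
    "\<And>i. i \<in> L \<Longrightarrow> release S R i < s \<Longrightarrow> demand S R i \<le> service \<sigma> i s"
    "\<And>t. s < t \<Longrightarrow> t \<le> d \<Longrightarrow>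
       \<exists>i\<in>L. release S R i < t \<and> service \<sigma> i t < demand S R i"
proof -
  \<comment> \<open>The strict \<open>release S R i < t\<close> ignores jobs released at
    \<open>t\<close> itself. Hence \<open>Q 0\<close> holds, and the start of the busy interval can
    be taken as a supremum.\<close>
  define Q where "Q t \<longleftrightarrow> (\<forall>i\<in>L. release S R i < t \<longrightarrow> demand S R i \<le> service \<sigma> i t)" for t
  define A where "A = {t \<in> {0..release S R j}. Q t}"
  have "0 \<in> A"
    using release_nonneg j by (force simp: A_def Q_def L_def)
  have bdd: "bdd_above A"
    by (rule bdd_aboveI[of _ "release S R j"]) (auto simp: A_def)
  have jL: "j \<in> L"
    using j higher_priority_irrefl by (simp add: L_def)
  show ?thesis
  proof (rule that)
    show "0 \<le> Sup A"
      using cSup_upper[OF \<open>0 \<in> A\<close> bdd] .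
    show "Sup A \<le> release S R j"
      using \<open>0 \<in> A\<close> by (intro cSup_least) (auto simp: A_def)
    \<comment> \<open>The supremum satisfies \<open>Q\<close> itself: a job released before
      \<open>Sup A\<close> is already released before some \<open>t\<close> in \<open>A\<close>, and
      is complete by then.\<close>
    show "demand S R i \<le> service \<sigma> i (Sup A)" if i: "i \<in> L" "release S R i < Sup A" for i
    proof -
      obtain t where t: "t \<in> A" "release S R i < t"
        using less_cSupD[of A "release S R i"] i \<open>0 \<in> A\<close> by auto
      then have "demand S R i \<le> service \<sigma> i t"
        using i by (simp add: A_def Q_def)
      also have "\<dots> \<le> service \<sigma> i (Sup A)"
        using cSup_upper[OF t(1) bdd] by (rule service_mono)
      finally show ?thesis .
    qed
    show "\<exists>i\<in>L. release S R i < t \<and> service \<sigma> i t < demand S R i" if t: "Sup A < t" "t \<le> d" for t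
    \<comment> \<open>Up to the release of \<open>j\<close>, leftover work exists because
      \<open>t\<close> exceeds \<open>Sup A\<close>; from then until \<open>d\<close>, the late job
      \<open>j\<close> is itself the witness.\<close>
    proof (cases "t \<le> release S R j")
      case True
      have "t \<notin> A"
        using cSup_upper[OF _ bdd, of t] t by auto
      then have "\<not> Q t"
        using True t cSup_upper[OF \<open>0 \<in> A\<close> bdd] by (auto simp: A_def)
      then show ?thesis
        by (auto simp: Q_def not_le)
    next
      case False
      then show ?thesis
        using jL late service_mono[OF t(2), of j] by (intro bexI[of _ j]) auto
    qed
  qed
qed

text \<open>Throughout the busy interval the processor executes only jobs of the level released
  since its start \<open>s\<close>. So \<open>t\<close> is at most the service these jobs have
  received by \<open>s + t\<close>, which falls short of their total demand.\<close>

lemma overload_if_late: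
  assumes j: "j \<in> jobs S R"
    and late: "service \<sigma> j (release S R j + workload_period S (workload_of j)) < demand S R j"
    and t: "0 < t" "t \<le> workload_period S (workload_of j)"
  defines "V \<equiv> {v \<in> workloads S. \<not> higher_priority S (workload_of j) v}"
  shows "t < (\<Sum>v\<in>V. workload_wcet S v * \<lceil>t / workload_period S v\<rceil>)"
proof -
  define L where "L = {i \<in> jobs S R. \<not> higher_priority S (workload_of j) (workload_of i)}"
  have d: "release S R j < release S R j + workload_period S (workload_of j)"
    using t by simp
  obtain s where s: "0 \<le> s" "s \<le> release S R j"
    "\<And>i. i \<in> L \<Longrightarrow> release S R i < s \<Longrightarrow> demand S R i \<le> service \<sigma> i s"
    "\<And>u. s < u \<Longrightarrow> u \<le> release S R j + workload_period S (workload_of j) \<Longrightarrow>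
       \<exists>i\<in>L. release S R i < u \<and> service \<sigma> i u < demand S R i"
    using busy_interval[OF j d late] unfolding L_def by blast
  define F where "F = {i \<in> jobs S R. workload_of i \<in> V \<and> s \<le> release S R i \<and> release S R i < s + t}"
  have fin: "finite F"
    and F: "(\<Sum>i\<in>F. demand S R i) \<le> (\<Sum>v\<in>V. workload_wcet S v * \<lceil>t / workload_period S v\<rceil>)"
    unfolding F_def using t by (intro demand_of_interval; auto simp: V_def)+
  \<comment> \<open>A level job unfinished at \<open>u\<close> was not released before
    \<open>s\<close>, since all such jobs were complete by \<open>s\<close>.\<close>
  have in_F: "i \<in> F"
    if "i \<in> L" "s \<le> u" "u \<le> s + t" "release S R i < s + t" "service \<sigma> i u < demand S R i" for i u
  proof -
    have "s \<le> release S R i"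
      using s(3)[OF that(1)] service_mono[OF that(2), of i] that(5) by fastforce
    then show ?thesis
      using that workload_of_job by (auto simp: F_def L_def V_def)
  qed
  \<comment> \<open>The interval is open because leftover work is guaranteed only after
    \<open>s\<close>; the endpoints have measure zero.\<close>
  have sub: "{s<..<s + t} \<subseteq> (\<Union>i\<in>F. {u \<in> {0..<s + t}. \<sigma> u = Some i})"
  proof
    fix u assume u: "u \<in> {s<..<s + t}"
    then obtain p where p: "p \<in> L" "release S R p < u" "service \<sigma> p u < demand S R p"
      using s(2) s(4)[of u] t by auto
    then have "p \<in> pending S R \<sigma> u"
      by (simp add: pending_def L_def)
    then obtain i where i: "\<sigma> u = Some i" "i \<in> pending S R \<sigma> u"
      "\<not> higher_priority S (workload_of j) (workload_of i)"
      using running_at_level[of u p "workload_of j"] p u s(1) by (auto simp: L_def)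
    then have "i \<in> F"
      using u by (intro in_F[of i u]) (auto simp: pending_def L_def)
    then show "u \<in> (\<Union>i\<in>F. {u \<in> {0..<s + t}. \<sigma> u = Some i})"
      using i u s(1) by auto
  qed
  have "t = measure lborel {s<..<s + t}"
    using t by simp
  also have "\<dots> \<le> measure lborel (\<Union>i\<in>F. {u \<in> {0..<s + t}. \<sigma> u = Some i})"
    using fin by (intro measure_mono_fmeasurable fmeasurable.finite_UN running_fmeasurable sub) auto
  also have "\<dots> \<le> (\<Sum>i\<in>F. service \<sigma> i (s + t))"
    unfolding service_def using fin by (intro measure_UNION_le running_sets)
  also have "\<dots> < (\<Sum>i\<in>F. demand S R i)"
  proof -
    \<comment> \<open>Strictness: at \<open>s + t\<close> the busy interval still supplies an
      unfinished job, and it belongs to \<open>F\<close>.\<close>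
    obtain i where i: "i \<in> L" "release S R i < s + t" "service \<sigma> i (s + t) < demand S R i"
      using s(2) s(4)[of "s + t"] t by auto
    then have "i \<in> F"
      using t by (intro in_F[of i "s + t"]) auto
    then show ?thesis
      using i fin service_le_demand by (intro sum_strict_mono_ex1) (auto simp: F_def)
  qed
  finally show ?thesis
    using F by simp
qed

section \<open>From the product bound to the deadlines\<close>

lemma completes_within_period:
  assumes bound: "(\<Prod>v\<in>workloads S. 1 + workload_wcet S v / workload_period S v) \<le> 2"
    and j: "j \<in> jobs S R"
  shows "demand S R j \<le> service \<sigma> j (release S R j + workload_period S (workload_of j))"
proof (rule ccontr)
  assume "\<not> ?thesis"
  then have late: "service \<sigma> j (release S R j + workload_period S (workload_of j)) < demand S R j"
    by simp
  define V where "V = {v \<in> workloads S. \<not> higher_priority S (workload_of j) v}"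
  have ratio: "0 \<le> workload_wcet S v / workload_period S v" if "v \<in> workloads S" for v
    using workload_wcet_pos[OF valid_sys that] workload_period_pos[OF valid_sys that] by simp
  \<comment> \<open>Passing to the level \<open>V\<close> of \<open>j\<close> only drops factors
    that are at least 1.\<close>
  have "(\<Prod>v\<in>V. 1 + workload_wcet S v / workload_period S v)
      \<le> (\<Prod>v\<in>workloads S. 1 + workload_wcet S v / workload_period S v)"
    by (intro prod_mono2) (auto simp: V_def intro!: add_nonneg_nonneg ratio)
  then have prod: "(\<Prod>v\<in>V. 1 + workload_wcet S v / workload_period S v) \<le> 2"
    using bound by simp
  have "\<exists>t. 0 < t \<and> t \<le> workload_period S (workload_of j) \<and>
      (\<Sum>v\<in>V. workload_wcet S v * \<lceil>t / workload_period S v\<rceil>) \<le> t"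
  \<comment> \<open>The distinguished index is the workload of \<open>j\<close>, which has the
    longest period within its own level.\<close>
  proof (rule hyperbolic_bound[OF _ _ _ _ _ prod])
    show "finite V"
      by (simp add: V_def)
    show "workload_of j \<in> V"
      using workload_of_job[OF j] higher_priority_irrefl by (simp add: V_def)
  next
    fix v assume "v \<in> V"
    then have v: "v \<in> workloads S" "\<not> higher_priority S (workload_of j) v"
      by (auto simp: V_def)
    show "0 < workload_period S v" "0 < workload_wcet S v"
      using workload_period_pos[OF valid_sys v(1)] workload_wcet_pos[OF valid_sys v(1)] .
    show "workload_period S v \<le> workload_period S (workload_of j)"
      by (rule workload_period_le[OF valid_sys workload_of_job[OF j] v])
  qed
  then obtain t where "0 < t" "t \<le> workload_period S (workload_of j)"
    "(\<Sum>v\<in>V. workload_wcet S v * \<lceil>t / workload_period S v\<rceil>) \<le> t"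
    by blast
  then show False
    using overload_if_late[OF j late, of t] unfolding V_def by simp
qed

lemma meets_deadlines_if_prod_le_2:
  assumes "(\<Prod>v\<in>workloads S. 1 + workload_wcet S v / workload_period S v) \<le> 2"
  shows "meets_deadlines S R \<sigma>"
  unfolding meets_deadlines_def
proof (intro conjI ballI)
  fix n k assume n: "n \<in> {1..num_devices S}" and k: "k \<in> release_ticks S (period S n)"
  define w where "w = bucket_of S n"
  have w: "w \<in> {1..num_buckets S}" "n \<in> set (bucket S w)"
    using bucket_of[OF valid_sys n] by (auto simp: w_def)
  have T: "period S n = bucket_period S w"
    using in_bucketD(2)[OF valid_sys w(2)] .
  have job: "Bucket_job w k \<in> jobs S R"
    using w k T by (auto simp: jobs_def)
  have "demand_through S R w k (Handle n) \<le> demand S R (Bucket_job w k)"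
    using k w T by (intro demand_through_le_demand) (auto simp: bucket_stages_def)
  also have "\<dots> \<le> service \<sigma> (Bucket_job w k) (real k * tick S + deadline S n)"
    using completes_within_period[OF assms job] T by (simp add: deadline_def)
  \<comment> \<open>The deadline instant belongs to the set whose infimum is the finish
    time.\<close>
  finally show "handle_finish S R \<sigma> n k \<le> ereal (real k * tick S + deadline S n)"
    using T w tick_le_bucket_period[OF valid_sys w(1)] valid_sys
    unfolding handle_finish_def Let_def w_def[symmetric]
    by (intro Inf_lower imageI) (auto simp: deadline_def valid_sys_def)
next
  fix b i assume b: "b \<in> {1..num_buses S}" and i: "i \<in> responses R b"
  have job: "Response b i \<in> jobs S R"
    using b i by (auto simp: jobs_def)
  have "bus_period S b \<le> bus_sep S b"
    by (simp add: bus_period_def)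
  have "demand S R (Response b i) \<le> service \<sigma> (Response b i) (arrival R b i + bus_period S b)"
    using completes_within_period[OF assms job] by simp
  also have "\<dots> \<le> service \<sigma> (Response b i) (arrival R b i + bus_sep S b)"
    using \<open>bus_period S b \<le> bus_sep S b\<close> by (intro service_mono) simp
  finally show "response_finish S R \<sigma> b i \<le> ereal (arrival R b i + bus_sep S b)"
    using b valid_sys unfolding response_finish_def
    by (intro Inf_lower imageI) (auto simp: valid_sys_def less_imp_le)
qed

end

theorem theorem2:
  fixes S :: sys
  assumes "valid_sys S"
    and "(\<Sum>b\<in>{1..num_buses S}. bus_wcet S b / bus_period S b)
           + (\<Sum>w\<in>{1..num_buckets S}. bucket_wcet S w / bucket_period S w)
         \<le> real (num_buses S + num_buckets S)
             * (2 powr (1 / real (num_buses S + num_buckets S)) - 1)"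
  shows "schedulable S"
proof -
  have "(\<Prod>v\<in>workloads S. 1 + workload_wcet S v / workload_period S v) \<le> 2"
  proof (rule prod_le_2_if_utilization_le)
    \<comment> \<open>There is at least one device, hence a bucket, so the number of workloads by
      which the mean divides is positive.\<close>
    show "workloads S \<noteq> {}"
      using num_buckets_pos[OF assms(1)] by (auto simp: workloads_def)
    show "0 \<le> workload_wcet S v / workload_period S v" if "v \<in> workloads S" for v
      using workload_wcet_pos[OF assms(1) that] workload_period_pos[OF assms(1) that] by simp
  qed (use assms(2) in \<open>simp_all add: sum_workloads card_workloads\<close>)
  then show ?thesis
    using assms(1) by (simp add: schedulable_def static_run.meets_deadlines_if_prod_le_2
        static_run.intro)
qed

end
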